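(* Suppose a group $G$ acts on a uniform space $X$. If the action is neutral and uniformly properly discontinuous, then the projection $p\colon X\to X/G$ is a uniform covering map.
   Context: All entourages are symmetric subsets containing the diagonal. The action is a left action by bijections; the maps $x\mapsto g\cdot x$ are not assumed uniformly continuous. $X/G$ is the orbit set and $p$ the quotient map. The action is neutral if for each entourage $E$ of $X$ there is an entourage $F$ of $X$ such that $(x,h\cdot y)\in F$ (with $x,y\in X$, $h\in G$) implies the existence of $g\in G$ with $(g\cdot x,y)\in E$. It is uniformly properly discontinuous if there is an entourage $E$ of $X$ such that for all $x\in X$ and $g\in G$, $(x,g\cdot x)\in E$ implies $g=1$. For $f\colon X\to Y$ and $E\subset X\times X$, $f(E)=\{(f(x),f(y)) : (x,y)\in E\}$. An $E$-chain is a finite sequence $x_1,\dots,x_n$ with $(x_i,x_{i+1})\in E$ for all $i<n$. A map $f\colon X\to Y$ generates the uniform structure on $Y$ if the sets $f(E)$, $E$ an entourage of $X$, are entourages of $Y$ and form a base of its uniform structure. A surjective $f$ has the chain lifting property if for any entourage $E$ of $X$ there is an entourage $F$ of $X$ such that for every $x_0\in X$ any $f(F)$-chain in $Y$ starting from $f(x_0)$ lifts to an $E$-chain starting from $x_0$. It has the uniqueness of chain lifts property if for every entourage $E$ of $X$ there is an entourage $F$ of $X$ such that any two $F$-chains $\alpha,\beta$ with $f(\alpha)=f(\beta)$ and the same initial point are equal. A uniform covering map is a map that generates the uniform structure on its target and has both properties. When $G$ acts neutrally, $X/G$ is given the uniform structure generated by $p$ (base: the sets $p(E)$). *)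

theory Defs
  imports Complex_Main "HOL-Algebra.Group_Action"
begin

text \<open>
  Uniform structures are presented by entourages on a carrier set, since the orbit set
  of an action is a set and not a type. All entourages are symmetric and contain the diagonal, so
  upward closure is restricted to symmetric supersets. No Hausdorff condition is imposed.
\<close>

locale uniform_structure =
  fixes X :: "'a set" and \<U> :: "('a \<times> 'a) set set"
  assumes carrier_entourage: "X \<times> X \<in> \<U>"
    and entourage_subset: "E \<in> \<U> \<Longrightarrow> E \<subseteq> X \<times> X"
    and entourage_sym: "E \<in> \<U> \<Longrightarrow> sym E"
    and entourage_diag: "E \<in> \<U> \<Longrightarrow> Id_on X \<subseteq> E"
    and entourage_Int: "E \<in> \<U> \<Longrightarrow> F \<in> \<U> \<Longrightarrow> E \<inter> F \<in> \<U>"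
    and entourage_mono: "E \<in> \<U> \<Longrightarrow> E \<subseteq> F \<Longrightarrow> F \<subseteq> X \<times> X \<Longrightarrow> sym F \<Longrightarrow> F \<in> \<U>"
    and entourage_half: "E \<in> \<U> \<Longrightarrow> \<exists>F\<in>\<U>. F O F \<subseteq> E"

text \<open>
  Every subset of a type of class \<open>uniform_space\<close> gives an instance, its entourages being the
  symmetric ones of the filter \<open>uniformity_on S\<close>.
\<close>

lemma uniform_structure_uniformity_on:
  fixes S :: "'a::uniform_space set"
  shows "uniform_structure S
    {E. E \<subseteq> S \<times> S \<and> sym E \<and> eventually (\<lambda>p. p \<in> E) (uniformity_on S)}"
    (is "uniform_structure S ?U")
proof
  show "S \<times> S \<in> ?U"
    by (auto simp: sym_def eventually_inf_principal)
next
  fix E assume E: "E \<in> ?U"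
  show "E \<subseteq> S \<times> S" "sym E" using E by auto
  have ev: "eventually (\<lambda>p. p \<in> S \<times> S \<longrightarrow> p \<in> E) uniformity"
    using E by (auto simp: eventually_inf_principal)
  show "Id_on S \<subseteq> E"
    using uniformity_refl[OF ev] by auto
  obtain D where D: "eventually D uniformity"
    "\<And>x y z. D (x, y) \<Longrightarrow> D (y, z) \<Longrightarrow> (x, z) \<in> S \<times> S \<Longrightarrow> (x, z) \<in> E"
    using uniformity_trans[OF ev] by blast
  define F where "F = {(x, y). x \<in> S \<and> y \<in> S \<and> D (x, y) \<and> D (y, x)}"
  have "eventually (\<lambda>p. p \<in> S \<times> S \<longrightarrow> p \<in> F) uniformity"
    using D(1) uniformity_sym[OF D(1)]
    by eventually_elim (auto simp: F_def)
  hence "F \<in> ?U" by (auto simp: F_def sym_def eventually_inf_principal)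
  moreover have "F O F \<subseteq> E" using D(2) by (auto simp: F_def)
  ultimately show "\<exists>F\<in>?U. F O F \<subseteq> E" by blast
next
  fix E F assume "E \<in> ?U" "F \<in> ?U"
  thus "E \<inter> F \<in> ?U" by (auto intro: sym_Int eventually_conj)
next
  fix E F assume "E \<in> ?U" "E \<subseteq> F" "F \<subseteq> S \<times> S" "sym F"
  thus "F \<in> ?U" by (auto elim: eventually_mono)
qed

definition generates_uniform_structure ::
  "('a \<times> 'a) set set \<Rightarrow> ('b \<times> 'b) set set \<Rightarrow> ('a \<Rightarrow> 'b) \<Rightarrow> bool" where
  "generates_uniform_structure \<U> \<V> f \<longleftrightarrow>
    (\<forall>E\<in>\<U>. map_prod f f ` E \<in> \<V>) \<and> (\<forall>V\<in>\<V>. \<exists>E\<in>\<U>. map_prod f f ` E \<subseteq> V)"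

text \<open>A chain consists of at least one point; a one-point chain imposes no condition on \<open>E\<close>.\<close>

definition chain_in :: "'a set \<Rightarrow> ('a \<times> 'a) set \<Rightarrow> 'a list \<Rightarrow> bool" where
  "chain_in X E xs \<longleftrightarrow>
    xs \<noteq> [] \<and> set xs \<subseteq> X \<and> successively (\<lambda>x y. (x, y) \<in> E) xs"

definition chain_lifting ::
  "'a set \<Rightarrow> ('a \<times> 'a) set set \<Rightarrow> 'b set \<Rightarrow> ('a \<Rightarrow> 'b) \<Rightarrow> bool" where
  "chain_lifting X \<U> Y f \<longleftrightarrow>
    (\<forall>E\<in>\<U>. \<exists>F\<in>\<U>. \<forall>x0\<in>X. \<forall>\<beta>.
      chain_in Y (map_prod f f ` F) \<beta> \<and> hd \<beta> = f x0 \<longrightarrow>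
      (\<exists>\<alpha>. chain_in X E \<alpha> \<and> hd \<alpha> = x0 \<and> map f \<alpha> = \<beta>))"

text \<open>
  As usually stated, the outer entourage does not occur in the condition on \<open>F\<close>. Requiring
  \<open>F \<subseteq> E\<close> would give an equivalent property, since entourages are closed under intersection.
\<close>

definition unique_chain_lifts ::
  "'a set \<Rightarrow> ('a \<times> 'a) set set \<Rightarrow> ('a \<Rightarrow> 'b) \<Rightarrow> bool" where
  "unique_chain_lifts X \<U> f \<longleftrightarrow>
    (\<forall>E\<in>\<U>. \<exists>F\<in>\<U>. \<forall>\<alpha> \<beta>.
      chain_in X F \<alpha> \<and> chain_in X F \<beta> \<and> map f \<alpha> = map f \<beta> \<and> hd \<alpha> = hd \<beta> \<longrightarrow> \<alpha> = \<beta>)"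

definition uniform_covering_map ::
  "'a set \<Rightarrow> ('a \<times> 'a) set set \<Rightarrow> 'b set \<Rightarrow> ('b \<times> 'b) set set \<Rightarrow> ('a \<Rightarrow> 'b) \<Rightarrow> bool" where
  "uniform_covering_map X \<U> Y \<V> f \<longleftrightarrow>
    uniform_structure X \<U> \<and> uniform_structure Y \<V> \<and> f ` X = Y \<and>
    generates_uniform_structure \<U> \<V> f \<and> chain_lifting X \<U> Y f \<and> unique_chain_lifts X \<U> f"

definition neutral_action ::
  "('g, 'm) monoid_scheme \<Rightarrow> 'a set \<Rightarrow> ('a \<times> 'a) set set \<Rightarrow> ('g \<Rightarrow> 'a \<Rightarrow> 'a) \<Rightarrow> bool" where
  "neutral_action G X \<U> \<phi> \<longleftrightarrow>
    (\<forall>E\<in>\<U>. \<exists>F\<in>\<U>. \<forall>x\<in>X. \<forall>y\<in>X. \<forall>h\<in>carrier G.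
      (x, \<phi> h y) \<in> F \<longrightarrow> (\<exists>g\<in>carrier G. (\<phi> g x, y) \<in> E))"

definition uniformly_properly_discontinuous ::
  "('g, 'm) monoid_scheme \<Rightarrow> 'a set \<Rightarrow> ('a \<times> 'a) set set \<Rightarrow> ('g \<Rightarrow> 'a \<Rightarrow> 'a) \<Rightarrow> bool" where
  "uniformly_properly_discontinuous G X \<U> \<phi> \<longleftrightarrow>
    (\<exists>E\<in>\<U>. \<forall>x\<in>X. \<forall>g\<in>carrier G. (x, \<phi> g x) \<in> E \<longrightarrow> g = \<one>\<^bsub>G\<^esub>)"

text \<open>
  The structure on \<open>X/G\<close> with base the sets \<open>p(E)\<close>, where \<open>p = orbit G \<phi>\<close>. It is a
  uniform structure only under a condition on the action such as neutrality.
\<close>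

definition orbit_entourages ::
  "('g, 'm) monoid_scheme \<Rightarrow> 'a set \<Rightarrow> ('a \<times> 'a) set set \<Rightarrow> ('g \<Rightarrow> 'a \<Rightarrow> 'a)
    \<Rightarrow> ('a set \<times> 'a set) set set" where
  "orbit_entourages G X \<U> \<phi> =
    {V. V \<subseteq> orbits G X \<phi> \<times> orbits G X \<phi> \<and> sym V \<and>
        (\<exists>E\<in>\<U>. map_prod (orbit G \<phi>) (orbit G \<phi>) ` E \<subseteq> V)}"

end

theory Submission
  imports Defs
begin

text \<open>
  Both hypotheses on the action are statements about single edges. Neutrality says that edges lift
  along the projection from any prescribed initial point: an edge of \<open>p(F)\<close> at \<open>p x\<close> comes from an
  edge \<open>(h x, b)\<close> of \<open>F\<close> somewhere else on the orbit of \<open>x\<close>, and neutrality moves \<open>b\<close> along its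
  orbit to a point that is \<open>E\<close>-close to \<open>x\<close> itself. Uniform proper discontinuity says that such a
  lift is unique once \<open>F\<close> is small: two lifts \<open>y\<close> and \<open>g y\<close> of the same edge at \<open>x\<close> are both
  \<open>F\<close>-close to \<open>x\<close>, hence \<open>F O F\<close>-close to each other, which forces \<open>g = 1\<close>.

  Edge lifting alone has two consequences for a map \<open>f\<close>, independent of any action. The images
  of entourages are the base of a uniform structure, because two composable edges of \<open>f(F)\<close> lift to
  two edges that really share their middle point (lemma \<open>uniform_structure_image\<close>). And chains
  lift, one edge after the other (lemma \<open>chain_lifting_if_edge_lifting\<close>). In the same way
  uniqueness of edge lifts propagates along chains (lemma \<open>unique_chain_lifts_if_edges\<close>).
\<close>

text \<open>
  The pair \<open>(a, b)\<close> represents an edge of \<open>f(F)\<close>. Its initial point \<open>a\<close> need not be the point \<open>x\<close>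
  at which the lift has to start; that is the whole content of the condition.
\<close>

definition edge_lifting :: "'a set \<Rightarrow> ('a \<times> 'a) set set \<Rightarrow> ('a \<Rightarrow> 'b) \<Rightarrow> bool" where
  "edge_lifting X \<U> f \<longleftrightarrow>
    (\<forall>E\<in>\<U>. \<exists>F\<in>\<U>. \<forall>x\<in>X. \<forall>(a, b)\<in>F. f a = f x \<longrightarrow> (\<exists>y. (x, y) \<in> E \<and> f y = f b))"

lemma edge_liftingE:
  assumes "edge_lifting X \<U> f" and "E \<in> \<U>"
  obtains F where "F \<in> \<U>"
    and "\<And>x a b. x \<in> X \<Longrightarrow> (a, b) \<in> F \<Longrightarrow> f a = f x \<Longrightarrow> \<exists>y. (x, y) \<in> E \<and> f y = f b"
  using assms unfolding edge_lifting_def by fast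

lemma sym_map_prod_image: "sym E \<Longrightarrow> sym (map_prod f f ` E)"
  by (force simp: sym_def)

definition image_entourages ::
  "'a set \<Rightarrow> ('a \<times> 'a) set set \<Rightarrow> ('a \<Rightarrow> 'b) \<Rightarrow> ('b \<times> 'b) set set" where
  "image_entourages X \<U> f =
    {V. V \<subseteq> f ` X \<times> f ` X \<and> sym V \<and> (\<exists>E\<in>\<U>. map_prod f f ` E \<subseteq> V)}"

lemma image_entourages_image:
  assumes U: "uniform_structure X \<U>" and E: "E \<in> \<U>"
  shows "map_prod f f ` E \<in> image_entourages X \<U> f"
proof -
  interpret uniform_structure X \<U> by fact
  have "map_prod f f ` E \<subseteq> f ` X \<times> f ` X"
    using entourage_subset[OF E] by fastforce
  with sym_map_prod_image[OF entourage_sym[OF E]] E show ?thesis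
    unfolding image_entourages_def by blast
qed

lemma generates_image_entourages:
  assumes "uniform_structure X \<U>"
  shows "generates_uniform_structure \<U> (image_entourages X \<U> f) f"
  unfolding generates_uniform_structure_def
proof
  show "\<forall>E\<in>\<U>. map_prod f f ` E \<in> image_entourages X \<U> f"
    using image_entourages_image[OF assms] by blast
  show "\<forall>V\<in>image_entourages X \<U> f. \<exists>E\<in>\<U>. map_prod f f ` E \<subseteq> V"
    by (simp add: image_entourages_def)
qed

text \<open>
  Edge lifting supplies the halves of an entourage. The edges \<open>(a, b)\<close> and \<open>(b', c)\<close> of \<open>X\<close> have
  composable images as soon as \<open>f b = f b'\<close>; lifting the second one to start at \<open>b\<close> makes them
  composable in \<open>X\<close>.
\<close>

lemma uniform_structure_image:
  assumes U: "uniform_structure X \<U>" and lift: "edge_lifting X \<U> f"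
  shows "uniform_structure (f ` X) (image_entourages X \<U> f)" (is "uniform_structure _ ?V")
proof -
  interpret uniform_structure X \<U> by fact
  show ?thesis
  proof
    show "f ` X \<times> f ` X \<in> ?V"
      using image_entourages_image[OF U carrier_entourage, of f]
      by (simp add: map_prod_surj_on[OF refl refl])
  next
    fix V assume V: "V \<in> ?V"
    then show "V \<subseteq> f ` X \<times> f ` X" "sym V" by (simp_all add: image_entourages_def)
    obtain E where E: "E \<in> \<U>" "map_prod f f ` E \<subseteq> V"
      using V by (auto simp: image_entourages_def)
    show "Id_on (f ` X) \<subseteq> V"
    proof
      fix q assume "q \<in> Id_on (f ` X)"
      then obtain x where x: "x \<in> X" "q = (f x, f x)" by auto
      then have "(x, x) \<in> E" using entourage_diag[OF E(1)] by auto
      from imageI[OF this, of "map_prod f f"] show "q \<in> V" using E(2) x(2) by auto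
    qed
    obtain H where H: "H \<in> \<U>" "H O H \<subseteq> E"
      using entourage_half[OF E(1)] by auto
    obtain F where F: "F \<in> \<U>"
      "\<And>x a b. x \<in> X \<Longrightarrow> (a, b) \<in> F \<Longrightarrow> f a = f x \<Longrightarrow> \<exists>y. (x, y) \<in> H \<and> f y = f b"
      using edge_liftingE[OF lift H(1)] by blast
    let ?W = "map_prod f f ` (H \<inter> F)"
    have "?W O ?W \<subseteq> V"
    proof
      fix q assume "q \<in> ?W O ?W"
      then obtain a b b' c where q: "q = (f a, f c)" "f b = f b'"
        and ab: "(a, b) \<in> H" and bc: "(b', c) \<in> F"
        by auto
      have "b \<in> X" using entourage_subset[OF H(1)] ab by auto
      then obtain c' where c': "(b, c') \<in> H" "f c' = f c"
        using F(2)[OF _ bc q(2)[symmetric]] by blast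
      have "(a, c') \<in> E" using H(2) ab c'(1) by auto
      then show "q \<in> V"
        using imageI[of "(a, c')" E "map_prod f f"] E(2) q(1) c'(2) by auto
    qed
    then show "\<exists>W\<in>?V. W O W \<subseteq> V"
      using image_entourages_image[OF U entourage_Int[OF H(1) F(1)]] by blast
  next
    fix V W assume V: "V \<in> ?V" and W: "W \<in> ?V"
    obtain E where E: "E \<in> \<U>" "map_prod f f ` E \<subseteq> V"
      using V by (auto simp: image_entourages_def)
    obtain F where F: "F \<in> \<U>" "map_prod f f ` F \<subseteq> W"
      using W by (auto simp: image_entourages_def)
    have "map_prod f f ` (E \<inter> F) \<subseteq> V \<inter> W" using E(2) F(2) by blast
    moreover have "V \<inter> W \<subseteq> f ` X \<times> f ` X" "sym (V \<inter> W)"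
      using V W by (auto simp: image_entourages_def intro: sym_Int)
    ultimately show "V \<inter> W \<in> ?V"
      using entourage_Int[OF E(1) F(1)] unfolding image_entourages_def mem_Collect_eq
      by (intro conjI bexI[of _ "E \<inter> F"])
  next
    fix V W assume V: "V \<in> ?V" and W: "V \<subseteq> W" "W \<subseteq> f ` X \<times> f ` X" "sym W"
    obtain E where E: "E \<in> \<U>" "map_prod f f ` E \<subseteq> V"
      using V by (auto simp: image_entourages_def)
    then show "W \<in> ?V"
      using W order_trans[OF E(2) W(1)] by (auto simp only: image_entourages_def)
  qed
qed

lemma chain_lifting_if_edge_lifting:
  assumes U: "uniform_structure X \<U>" and lift: "edge_lifting X \<U> f"
  shows "chain_lifting X \<U> Y f"
  unfolding chain_lifting_def
proof
  interpret uniform_structure X \<U> by fact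
  fix E assume E: "E \<in> \<U>"
  obtain F where F: "F \<in> \<U>"
    "\<And>x a b. x \<in> X \<Longrightarrow> (a, b) \<in> F \<Longrightarrow> f a = f x \<Longrightarrow> \<exists>y. (x, y) \<in> E \<and> f y = f b"
    using edge_liftingE[OF lift E] by blast
  have "\<exists>\<alpha>. chain_in X E \<alpha> \<and> hd \<alpha> = x \<and> map f \<alpha> = \<beta>"
    if "chain_in Y (map_prod f f ` F) \<beta>" "hd \<beta> = f x" "x \<in> X" for \<beta> x
    using that
  proof (induction \<beta> arbitrary: x)
    case Nil
    then show ?case by (simp add: chain_in_def)
  next
    case (Cons u \<beta>)
    show ?case
    proof (cases \<beta>)
      case Nil
      then have "chain_in X E [x] \<and> hd [x] = x \<and> map f [x] = u # \<beta>"
        using Cons.prems by (simp add: chain_in_def)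
      then show ?thesis by (rule exI)
    next
      case (Cons v \<gamma>)
      have edge: "(u, v) \<in> map_prod f f ` F" and rest: "chain_in Y (map_prod f f ` F) \<beta>"
        using Cons.prems(1) Cons by (auto simp: chain_in_def)
      obtain a b where ab: "(a, b) \<in> F" "f a = f x" "f b = v"
        using edge Cons.prems(2) by auto
      obtain y where y: "(x, y) \<in> E" "f y = v"
        using F(2)[OF Cons.prems(3) ab(1,2)] ab(3) by auto
      have "y \<in> X" using entourage_subset[OF E] y(1) by auto
      moreover have "hd \<beta> = f y" using y(2) Cons by simp
      ultimately obtain \<alpha> where \<alpha>: "chain_in X E \<alpha>" "hd \<alpha> = y" "map f \<alpha> = \<beta>"
        using Cons.IH[OF rest] by metis
      have "chain_in X E (x # \<alpha>)"
        using \<alpha>(1,2) y(1) Cons.prems(3) by (auto simp: chain_in_def successively_Cons)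
      moreover have "map f (x # \<alpha>) = u # \<beta>"
        using \<alpha>(3) Cons.prems(2) by simp
      ultimately show ?thesis by (intro exI[of _ "x # \<alpha>"]) simp
    qed
  qed
  then show "\<exists>F\<in>\<U>. \<forall>x0\<in>X. \<forall>\<beta>. chain_in Y (map_prod f f ` F) \<beta> \<and> hd \<beta> = f x0 \<longrightarrow>
      (\<exists>\<alpha>. chain_in X E \<alpha> \<and> hd \<alpha> = x0 \<and> map f \<alpha> = \<beta>)"
    using F(1) by blast
qed

lemma unique_chain_lifts_if_edges:
  assumes F: "F \<in> \<U>"
    and edges: "\<And>x y z. (x, y) \<in> F \<Longrightarrow> (x, z) \<in> F \<Longrightarrow> f y = f z \<Longrightarrow> y = z"
  shows "unique_chain_lifts X \<U> f"
proof -
  have "\<alpha> = \<beta>"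
    if "chain_in X F \<alpha>" "chain_in X F \<beta>" "map f \<alpha> = map f \<beta>" "hd \<alpha> = hd \<beta>" for \<alpha> \<beta>
    using that
  proof (induction \<alpha> arbitrary: \<beta>)
    case Nil
    then show ?case by (simp add: chain_in_def)
  next
    case (Cons x \<alpha>)
    then obtain \<gamma> where \<gamma>: "\<beta> = x # \<gamma>" "map f \<alpha> = map f \<gamma>"
      by (cases \<beta>) auto
    show ?case
    proof (cases \<alpha>)
      case Nil
      then show ?thesis using \<gamma> by simp
    next
      case (Cons y \<alpha>')
      then obtain z \<gamma>' where z: "\<gamma> = z # \<gamma>'" "f y = f z"
        using \<gamma>(2) by (cases \<gamma>) auto
      have "(x, y) \<in> F" "(x, z) \<in> F" "chain_in X F \<alpha>" "chain_in X F \<gamma>"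
        using Cons.prems(1,2) \<gamma>(1) z(1) Cons by (auto simp: chain_in_def)
      moreover from this have "y = z" using edges z(2) by blast
      ultimately have "\<alpha> = \<gamma>" using Cons.IH[of \<gamma>] \<gamma>(2) z(1) Cons by simp
      then show ?thesis using \<gamma>(1) by simp
    qed
  qed
  then show ?thesis unfolding unique_chain_lifts_def using F by blast
qed

context group_action
begin

lemma orbit_eq_imp_translate:
  assumes "x \<in> E" "orbit G \<phi> x = orbit G \<phi> y"
  shows "\<exists>g\<in>carrier G. x = \<phi> g y"
  using orbit_refl[OF assms(1)] assms(2) by (auto simp: orbit_def)

lemma orbit_translate:
  assumes "g \<in> carrier G" "x \<in> E"
  shows "orbit G \<phi> (\<phi> g x) = orbit G \<phi> x"
proof -
  have gx: "\<phi> g x \<in> E" using element_image assms by blast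
  have gx_orb: "\<phi> g x \<in> orbit G \<phi> x" using assms(1) by (auto simp: orbit_def)
  have x_orb: "x \<in> orbit G \<phi> (\<phi> g x)" using orbit_sym[OF assms(2) gx gx_orb] .
  have sub: "orbit G \<phi> y \<subseteq> E" if "y \<in> E" for y
    using element_image that by (auto simp: orbit_def)
  show ?thesis
    using orbit_trans[OF assms(2) gx _ gx_orb] orbit_trans[OF gx assms(2) _ x_orb]
      sub[OF gx] sub[OF assms(2)]
    by blast
qed

lemma orbits_eq_image: "orbits G E \<phi> = orbit G \<phi> ` E"
  by (auto simp: orbits_def)

text \<open>
  Given an edge \<open>(a, b)\<close> with \<open>a = h x\<close>, neutrality applies to the reversed edge \<open>(b, h x)\<close>: it
  is the endpoint \<open>b\<close> that may move along its orbit, while \<open>x\<close> stays fixed.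
\<close>

lemma edge_lifting_orbit_if_neutral:
  assumes U: "uniform_structure E \<U>" and neutral: "neutral_action G E \<U> \<phi>"
  shows "edge_lifting E \<U> (orbit G \<phi>)"
  unfolding edge_lifting_def
proof
  interpret uniform_structure E \<U> by fact
  fix D assume D: "D \<in> \<U>"
  obtain F where F: "F \<in> \<U>"
    "\<And>x y h. x \<in> E \<Longrightarrow> y \<in> E \<Longrightarrow> h \<in> carrier G \<Longrightarrow> (x, \<phi> h y) \<in> F \<Longrightarrow>
      \<exists>g\<in>carrier G. (\<phi> g x, y) \<in> D"
    using neutral D unfolding neutral_action_def by metis
  have "\<exists>y. (x, y) \<in> D \<and> orbit G \<phi> y = orbit G \<phi> b"
    if x: "x \<in> E" and ab: "(a, b) \<in> F" and orb: "orbit G \<phi> a = orbit G \<phi> x" for x a b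
  proof -
    have abE: "a \<in> E" "b \<in> E" using entourage_subset[OF F(1)] ab by auto
    obtain h where h: "h \<in> carrier G" "a = \<phi> h x"
      using orbit_eq_imp_translate[OF abE(1) orb] by blast
    have "(b, \<phi> h x) \<in> F" using ab h(2) entourage_sym[OF F(1)] by (auto dest: symD)
    then obtain g where g: "g \<in> carrier G" "(\<phi> g b, x) \<in> D"
      using F(2) abE(2) x h(1) by blast
    then show ?thesis
      using orbit_translate[OF g(1) abE(2)] entourage_sym[OF D] by (auto dest: symD)
  qed
  then show "\<exists>F\<in>\<U>. \<forall>x\<in>E. \<forall>(a, b)\<in>F. orbit G \<phi> a = orbit G \<phi> x \<longrightarrow>
      (\<exists>y. (x, y) \<in> D \<and> orbit G \<phi> y = orbit G \<phi> b)"
    by (intro bexI[OF _ F(1)] ballI) auto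
qed

lemma unique_chain_lifts_orbit:
  assumes U: "uniform_structure E \<U>" and upd: "uniformly_properly_discontinuous G E \<U> \<phi>"
  shows "unique_chain_lifts E \<U> (orbit G \<phi>)"
proof -
  interpret uniform_structure E \<U> by fact
  obtain D where D: "D \<in> \<U>"
    "\<And>x g. x \<in> E \<Longrightarrow> g \<in> carrier G \<Longrightarrow> (x, \<phi> g x) \<in> D \<Longrightarrow> g = \<one>\<^bsub>G\<^esub>"
    using upd unfolding uniformly_properly_discontinuous_def by blast
  obtain F where F: "F \<in> \<U>" "F O F \<subseteq> D"
    using entourage_half[OF D(1)] by auto
  have "y = z" if xy: "(x, y) \<in> F" and xz: "(x, z) \<in> F" and orb: "orbit G \<phi> y = orbit G \<phi> z"
    for x y z
  proof -
    have yz: "y \<in> E" "z \<in> E" using entourage_subset[OF F(1)] xy xz by auto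
    obtain g where g: "g \<in> carrier G" "z = \<phi> g y"
      using orbit_eq_imp_translate[OF yz(2)] orb by metis
    have "(y, x) \<in> F" using xy entourage_sym[OF F(1)] by (auto dest: symD)
    then have "(y, \<phi> g y) \<in> D" using F(2) xz g(2) by auto
    then have "g = \<one>\<^bsub>G\<^esub>" using D(2) yz(1) g(1) by blast
    then show ?thesis using g(2) id_eq_one yz(1) by (metis restrict_apply')
  qed
  then show ?thesis using unique_chain_lifts_if_edges[OF F(1)] by blast
qed

end

theorem corollary3p6:
  fixes G :: "('g, 'm) monoid_scheme"
    and X :: "'a set"
    and \<U> :: "('a \<times> 'a) set set"
    and \<phi> :: "'g \<Rightarrow> 'a \<Rightarrow> 'a"
  assumes "uniform_structure X \<U>"
    and "group_action G X \<phi>"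
    and "neutral_action G X \<U> \<phi>"
    and "uniformly_properly_discontinuous G X \<U> \<phi>"
  shows "uniform_covering_map X \<U> (orbits G X \<phi>) (orbit_entourages G X \<U> \<phi>) (orbit G \<phi>)"
proof -
  interpret group_action G X \<phi> by fact
  have lift: "edge_lifting X \<U> (orbit G \<phi>)"
    using edge_lifting_orbit_if_neutral assms(1,3) .
  have "orbit_entourages G X \<U> \<phi> = image_entourages X \<U> (orbit G \<phi>)"
    by (simp add: orbit_entourages_def image_entourages_def orbits_eq_image)
  then show ?thesis
    unfolding uniform_covering_map_def
    using assms(1) orbits_eq_image uniform_structure_image[OF assms(1) lift]
      generates_image_entourages[OF assms(1)] chain_lifting_if_edge_lifting[OF assms(1) lift]
      unique_chain_lifts_orbit[OF assms(1,4)]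
    by simp
qed

end
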